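(* Let $K$ be a (nonempty) bounded set in a finite-dimensional real normed space $\mathbb{M}^d=(\mathbb{R}^d,\|\cdot\|)$, and suppose that $K$ has a unique completion $K^c$. Then $\lambda_K=\lambda_{K^c}$ and $\mathrm{Ch}(K)=\mathrm{Ch}(K^c)$.
   Context: $B(x,\lambda)=\{y:\|y-x\|\le\lambda\}$ denotes the closed ball with center $x$ and radius $\lambda$. For a nonempty bounded set $K$, $\operatorname{diam}(K)=\sup\{\|x-y\|:x,y\in K\}$. The minimal enclosing radius (Chebyshev radius) $\lambda_K$ is the smallest number such that $K\subseteq B(x,\lambda_K)$ for some $x$; such a ball $B(x,\lambda_K)$ is a minimal enclosing ball of $K$. The Chebyshev set $\mathrm{Ch}(K)$ is the set of all centers $x$ of minimal enclosing balls of $K$. A bounded set is complete if it cannot be enlarged by additional points without increasing its diameter. A completion of $K$ is a complete set that contains $K$ and has the same diameter as $K$. *)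

theory Defs
  imports "HOL-Analysis.Analysis"
begin

text \<open>
  The least \<open>r\<close> exists for every nonempty bounded \<open>K\<close> in a finite-dimensional space; negative
  \<open>r\<close> do not interfere, since \<open>cball x r\<close> is then empty.
\<close>
definition chebyshev_radius :: "'a::real_normed_vector set \<Rightarrow> real" where
  "chebyshev_radius K = (LEAST r. \<exists>x. K \<subseteq> cball x r)"

definition chebyshev_set :: "'a::real_normed_vector set \<Rightarrow> 'a set" where
  "chebyshev_set K = {x. K \<subseteq> cball x (chebyshev_radius K)}"

text \<open>
  This is completeness with respect to the diameter, unrelated to the library's metric
  \<^const>\<open>complete\<close>. As \<open>diameter\<close> is monotone on bounded sets, excluding the
  addition of a single point excludes the addition of any set of points. The empty set is not
  complete, as adding one point to it keeps the diameter 0.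
\<close>
definition diam_complete :: "'a::real_normed_vector set \<Rightarrow> bool" where
  "diam_complete C \<longleftrightarrow> bounded C \<and> (\<forall>x. x \<notin> C \<longrightarrow> diameter C < diameter (insert x C))"

definition is_completion :: "'a::real_normed_vector set \<Rightarrow> 'a set \<Rightarrow> bool" where
  "is_completion K C \<longleftrightarrow> diam_complete C \<and> K \<subseteq> C \<and> diameter C = diameter K"

end

theory Submission
  imports Defs
begin

text \<open>
  Let \<open>D\<close> be the diameter of \<open>K\<close>. If every point of \<open>K\<close> has distance at most \<open>D\<close> from \<open>z\<close>, then
  \<open>insert z K\<close> has a completion, which is also a completion of \<open>K\<close>; by uniqueness \<open>z \<in> K\<^sup>c\<close>.
  Now let \<open>K \<subseteq> cball x r\<close> with \<open>r \<le> D\<close>, and suppose some \<open>y \<in> K\<^sup>c\<close> lies outside this ball. Moving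
  \<open>x\<close> away from \<open>y\<close> by \<open>D - r\<close> gives \<open>z\<close> with \<open>K \<subseteq> cball z D\<close>, hence \<open>z \<in> K\<^sup>c\<close>, but
  \<open>dist z y > D\<close>, a contradiction. So the balls of radius at most \<open>D\<close> containing \<open>K\<close> are those
  containing \<open>K\<^sup>c\<close>. Finite dimension serves only to ensure that the minimal radius is attained.
\<close>

text \<open>Zorn's lemma: in a maximal superset of \<open>K\<close> with all pairwise distances at
  most \<open>diameter K\<close>, a point that could be added without raising the diameter would
  contradict maximality.\<close>

lemma completion_exists:
  fixes K :: "'a::real_normed_vector set"
  assumes "bounded K"
  shows "\<exists>C. is_completion K C"
proof -
  \<comment> \<open>Bounding distances instead of \<open>diameter\<close> forces boundedness,
    without which \<open>diameter\<close> is unspecified, and passes to unions of chains, where two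
    points always share one member.\<close>
  define \<A> where "\<A> = {C. K \<subseteq> C \<and> (\<forall>x\<in>C. \<forall>y\<in>C. dist x y \<le> diameter K)}"
  have diam_\<A>: "bounded C \<and> diameter C = diameter K" if "C \<in> \<A>" for C
  proof -
    have "bounded C"
      using that by (auto simp: \<A>_def bounded_two_points)
    moreover have "diameter C \<le> diameter K"
      using that diameter_ge_0[OF assms] by (intro diameter_le) (auto simp: \<A>_def dist_norm)
    ultimately show ?thesis
      using that diameter_subset[of K C] by (auto simp: \<A>_def)
  qed
  have "\<exists>M\<in>\<A>. \<forall>X\<in>\<A>. M \<subseteq> X \<longrightarrow> X = M"
  proof (rule subset_Zorn_nonempty)
    show "\<A> \<noteq> {}"
      using diameter_bounded_bound[OF assms] by (auto simp: \<A>_def)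
    fix \<C> assume "\<C> \<noteq> {}" and chain: "subset.chain \<A> \<C>"
    have "dist x y \<le> diameter K" if "x \<in> \<Union>\<C>" "y \<in> \<Union>\<C>" for x y
    proof -
      obtain X Y where "X \<in> \<C>" "x \<in> X" "Y \<in> \<C>" "y \<in> Y"
        using \<open>x \<in> \<Union>\<C>\<close> \<open>y \<in> \<Union>\<C>\<close> by blast
      moreover have "X \<subseteq> Y \<or> Y \<subseteq> X" "X \<in> \<A>" "Y \<in> \<A>"
        using chain \<open>X \<in> \<C>\<close> \<open>Y \<in> \<C>\<close> by (auto simp: subset_chain_def)
      ultimately show ?thesis
        unfolding \<A>_def by blast
    qed
    moreover have "K \<subseteq> \<Union>\<C>"
      using chain \<open>\<C> \<noteq> {}\<close> unfolding subset_chain_def \<A>_def by blast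
    ultimately show "\<Union>\<C> \<in> \<A>"
      by (simp add: \<A>_def)
  qed
  then obtain M where M: "M \<in> \<A>" and maximal: "\<And>X. X \<in> \<A> \<Longrightarrow> M \<subseteq> X \<Longrightarrow> X = M"
    by blast
  have "diameter M < diameter (insert x M)" if "x \<notin> M" for x
  proof (rule ccontr)
    assume "\<not> diameter M < diameter (insert x M)"
    then have "diameter (insert x M) \<le> diameter K" "bounded (insert x M)"
      using diam_\<A>[OF M] by auto
    then have "\<forall>u\<in>insert x M. \<forall>v\<in>insert x M. dist u v \<le> diameter K"
      using diameter_bounded_bound order_trans by blast
    then have "insert x M \<in> \<A>"
      using M unfolding \<A>_def by blast
    then show False
      using maximal[of "insert x M"] \<open>x \<notin> M\<close> by blast
  qed
  then have "is_completion K M"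
    using M diam_\<A>[OF M] by (auto simp: is_completion_def diam_complete_def \<A>_def)
  then show ?thesis ..
qed

lemma unique_completion_subset_cball:
  fixes K :: "'a::real_normed_vector set"
  assumes "K \<noteq> {}" and "bounded K"
    and Kc: "is_completion K Kc"
    and unique: "\<And>C. is_completion K C \<Longrightarrow> C = Kc"
    and x: "K \<subseteq> cball x r" and r: "r \<le> diameter K"
  shows "Kc \<subseteq> cball x r"
proof (rule ccontr)
  assume "\<not> Kc \<subseteq> cball x r"
  then obtain y where "y \<in> Kc" and y: "norm (y - x) > r"
    by (metis dist_norm dist_commute mem_cball not_le subsetI)
  obtain k where "k \<in> K"
    using \<open>K \<noteq> {}\<close> by blast
  then have "dist x k \<le> r"
    using x by auto
  then have "0 \<le> r"
    using zero_le_dist order_trans by blast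
  then have pos: "norm (y - x) > 0"
    using y by linarith
  \<comment> \<open>The scaling puts \<open>z\<close> on the line through \<open>y\<close> and
    \<open>x\<close>, beyond \<open>x\<close>, at distance \<open>diameter K - r\<close> from
    \<open>x\<close>.\<close>
  define s where "s = (diameter K - r) / norm (y - x)"
  define z where "z = x - s *\<^sub>R (y - x)"
  have s: "0 \<le> s" "s * norm (y - x) = diameter K - r"
    using pos r by (auto simp: s_def)
  have "dist z x = diameter K - r"
    using s by (simp add: z_def dist_norm)
  then have "dist z v \<le> diameter K" if "v \<in> K" for v
    using x that dist_triangle[of z v x] by auto
  then have Kz: "K \<subseteq> cball z (diameter K)"
    by auto
  have "z \<in> Kc"
  proof -
    have "dist u v \<le> diameter K" if "u \<in> insert z K" "v \<in> insert z K" for u v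
      using that Kz diameter_bounded_bound[OF \<open>bounded K\<close>] diameter_ge_0[OF \<open>bounded K\<close>]
      by (auto simp: dist_commute)
    then have "diameter (insert z K) \<le> diameter K"
      by (intro diameter_le) (auto simp: dist_norm)
    \<comment> \<open>Since adding \<open>z\<close> keeps the diameter, a completion of
      \<open>insert z K\<close> is one of \<open>K\<close>, so uniqueness applies.\<close>
    then have diam: "diameter (insert z K) = diameter K"
      using diameter_subset[of K "insert z K"] \<open>bounded K\<close>
      by (simp add: subset_insertI)
    obtain C where C: "is_completion (insert z K) C"
      using completion_exists[of "insert z K"] \<open>bounded K\<close> by auto
    then have "is_completion K C"
      by (simp add: is_completion_def diam)
    then show "z \<in> Kc"
      using unique C by (auto simp: is_completion_def)
  qed
  then have "dist y z \<le> diameter K"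
    using \<open>y \<in> Kc\<close> Kc diameter_bounded_bound[of Kc y z]
    by (auto simp: is_completion_def diam_complete_def)
  \<comment> \<open>As \<open>x\<close> lies between \<open>y\<close> and \<open>z\<close>, the
    triangle inequality is an equality here, which gives a distance above
    \<open>diameter K\<close>.\<close>
  moreover have "y - z = (1 + s) *\<^sub>R (y - x)"
    by (simp add: z_def algebra_simps)
  then have "dist y z = norm (y - x) + (diameter K - r)"
    using s by (simp add: dist_norm distrib_right)
  ultimately show False
    using y by linarith
qed

text \<open>Heine-Borel for an arbitrary norm, by induction on the spanning set. The radius varies
  because the component in the old span may be longer than the vector itself.\<close>

lemma compact_cball_Int_span:
  fixes B :: "'a::real_normed_vector set"
  assumes "finite B"
  shows "compact (cball 0 R \<inter> span B)"
  using assms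
proof (induction B arbitrary: R rule: finite_induct)
  case empty
  show ?case
    by (simp add: finite_imp_compact)
next
  case (insert b B)
  show ?case
  proof (cases "b \<in> span B")
    case True
    then show ?thesis
      using insert.IH by (simp add: span_redundant)
  next
    case False
    \<comment> \<open>A convergent sequence is bounded, so it stays in one of the sets that are
      compact by induction.\<close>
    have "closed (span B)"
      unfolding closed_sequential_limits
    proof (intro allI impI, elim conjE)
      fix f l assume f: "\<forall>n. f n \<in> span B" and lim: "f \<longlonglongrightarrow> l"
      obtain M where "\<forall>n. norm (f n) \<le> M"
        using lim convergent_imp_bounded[of f l] by (auto simp: bounded_iff)
      then have "\<forall>n. f n \<in> cball 0 M \<inter> span B"
        using f by auto
      then have "l \<in> cball 0 M \<inter> span B"
        using lim compact_imp_closed[OF insert.IH[of M]] closed_sequentially by blast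
      then show "l \<in> span B"
        by blast
    qed
    \<comment> \<open>The distance from \<open>b\<close> to the closed old span is positive and
      controls the coefficient of \<open>b\<close>: divide \<open>t *\<^sub>R b + y\<close> by
      \<open>t\<close>.\<close>
    define d where "d = infdist b (span B)"
    have "span B \<noteq> {}"
      using span_zero by blast
    then have "d > 0"
      using False \<open>closed (span B)\<close> infdist_nonneg[of b "span B"]
      by (auto simp: d_def in_closed_iff_infdist_zero less_le)
    have d: "\<bar>t\<bar> * d \<le> norm (t *\<^sub>R b + y)" if "y \<in> span B" for t y
    proof (cases "t = 0")
      case False
      have "- (y /\<^sub>R t) \<in> span B"
        using that by (intro span_neg span_scale)
      then have "d \<le> norm (b + y /\<^sub>R t)"
        using infdist_le[of "- (y /\<^sub>R t)" "span B" b] by (simp add: d_def dist_norm)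
      then have "\<bar>t\<bar> * d \<le> norm (t *\<^sub>R (b + y /\<^sub>R t))"
        by (simp add: mult_left_mono)
      then show ?thesis
        using False by (simp add: scaleR_right_distrib)
    qed simp
    \<comment> \<open>\<open>T\<close> bounds the coefficient of \<open>b\<close> for vectors of
      norm at most \<open>R\<close>; the remainder then has norm at most
      \<open>R + T * norm b\<close>. So the compact image \<open>S\<close> covers the required part
      of the new span.\<close>
    define T where "T = R / d"
    define S where
      "S = (\<lambda>(t, y). t *\<^sub>R b + y) ` ({- T..T} \<times> (cball 0 (R + T * norm b) \<inter> span B))"
    have "compact S"
      unfolding S_def
      by (intro compact_continuous_image compact_Times compact_Icc insert.IH)
        (auto simp: case_prod_unfold intro!: continuous_intros)
    moreover have "cball 0 R \<inter> span (insert b B) = cball 0 R \<inter> S"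
    proof (intro subset_antisym subsetI)
      fix x assume x: "x \<in> cball 0 R \<inter> span (insert b B)"
      then obtain t where t: "x - t *\<^sub>R b \<in> span B"
        by (auto simp: span_insert)
      have "\<bar>t\<bar> * d \<le> R"
        using d[OF t, of t] x by simp
      then have T: "\<bar>t\<bar> \<le> T"
        using \<open>d > 0\<close> by (simp add: T_def field_simps)
      then have "\<bar>t\<bar> * norm b \<le> T * norm b"
        by (simp add: mult_right_mono)
      then have "norm (x - t *\<^sub>R b) \<le> R + T * norm b"
        using norm_triangle_ineq4[of x "t *\<^sub>R b"] x by simp
      then have "(t, x - t *\<^sub>R b) \<in> {- T..T} \<times> (cball 0 (R + T * norm b) \<inter> span B)"
        using T t by auto
      then have "x \<in> S"
        unfolding S_def by (intro image_eqI) auto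
      then show "x \<in> cball 0 R \<inter> S"
        using x by blast
    next
      fix x assume "x \<in> cball 0 R \<inter> S"
      then show "x \<in> cball 0 R \<inter> span (insert b B)"
        by (auto simp: S_def intro!: span_add[OF span_scale[OF span_base]]
          intro: subsetD[OF span_mono[OF subset_insertI]])
    qed
    ultimately show ?thesis
      by (simp add: closed_Int_compact)
  qed
qed

text \<open>\<open>LEAST\<close> is only meaningful if the infimum of the radii is attained. Centers
  of nearly minimal balls have a convergent subsequence, and its limit is the center of a minimal
  ball.\<close>

lemma chebyshev_radius_attained:
  fixes K B :: "'a::real_normed_vector set"
  assumes "finite B" and "span B = (UNIV :: 'a set)"
    and "K \<noteq> {}" and "bounded K"
  shows "\<exists>x. K \<subseteq> cball x (chebyshev_radius K)"
    and "K \<subseteq> cball y r \<Longrightarrow> chebyshev_radius K \<le> r"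
proof -
  define P where "P r \<longleftrightarrow> (\<exists>x. K \<subseteq> cball x r)" for r
  obtain k where "k \<in> K"
    using \<open>K \<noteq> {}\<close> by blast
  have nonneg: "0 \<le> r" if "P r" for r
  proof -
    obtain x where "K \<subseteq> cball x r"
      using \<open>P r\<close> by (auto simp: P_def)
    then have "dist x k \<le> r"
      using \<open>k \<in> K\<close> by auto
    then show ?thesis
      using zero_le_dist order_trans by blast
  qed
  have bdd: "bdd_below {r. P r}"
    by (rule bdd_belowI[of _ 0]) (simp add: nonneg)
  define \<rho> where "\<rho> = Inf {r. P r}"
  have le: "\<rho> \<le> r" if "P r" for r
    unfolding \<rho>_def using that bdd by (intro cInf_lower) auto
  have "K \<subseteq> cball k (diameter K)"
    using \<open>k \<in> K\<close> diameter_bounded_bound[OF \<open>bounded K\<close>] by auto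
  then have "P (diameter K)"
    unfolding P_def by blast
  then have nonempty: "{r. P r} \<noteq> {}"
    by blast
  have compact: "compact (cball c r)" for c :: 'a and r
  proof -
    have "compact (cball (0::'a) (norm c + r))"
      using compact_cball_Int_span[OF \<open>finite B\<close>, of "norm c + r"] assms(2) by simp
    moreover have "cball c r \<subseteq> cball 0 (norm c + r)"
    proof
      fix v assume "v \<in> cball c r"
      then show "v \<in> cball 0 (norm c + r)"
        using norm_triangle_ineq2[of v c] by (simp add: dist_norm norm_minus_commute)
    qed
    ultimately show ?thesis
      using compact_Int_closed[of "cball 0 (norm c + r)" "cball c r"] by (simp add: Int_absorb1)
  qed
  have "\<exists>x. K \<subseteq> cball x (\<rho> + 1 / Suc n)" for n
  proof -
    have "\<rho> < \<rho> + 1 / Suc n"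
      by simp
    then obtain r where "P r" and r: "r < \<rho> + 1 / Suc n"
      unfolding \<rho>_def using cInf_lessD[OF nonempty] by fastforce
    then obtain x where "K \<subseteq> cball x r"
      by (auto simp: P_def)
    then show ?thesis
      using r subset_cball[of r "\<rho> + 1 / Suc n" x] by fastforce
  qed
  then obtain x where x: "\<And>n. K \<subseteq> cball (x n) (\<rho> + 1 / Suc n)"
    by metis
  \<comment> \<open>Each ball contains the fixed point \<open>k\<close>, so all centers lie in one
    compact ball around \<open>k\<close>.\<close>
  have "x n \<in> cball k (\<rho> + 1)" for n
  proof -
    have "dist k (x n) \<le> \<rho> + 1 / Suc n"
      using x[of n] \<open>k \<in> K\<close> by (auto simp: dist_commute)
    also have "\<dots> \<le> \<rho> + 1"
      by simp
    finally show ?thesis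
      by simp
  qed
  then obtain l s where "strict_mono (s :: nat \<Rightarrow> nat)" and lim: "(x \<circ> s) \<longlonglongrightarrow> l"
    using compact_imp_seq_compact[OF compact] by (metis seq_compactE)
  have "(\<lambda>n. \<rho> + 1 / Suc n) \<longlonglongrightarrow> \<rho> + 0"
    by (intro tendsto_intros LIMSEQ_Suc[OF lim_1_over_n])
  then have lim': "(\<lambda>n. \<rho> + 1 / Suc (s n)) \<longlonglongrightarrow> \<rho>"
    using LIMSEQ_subseq_LIMSEQ[OF _ \<open>strict_mono s\<close>] by (fastforce simp: o_def)
  have "dist l v \<le> \<rho>" if "v \<in> K" for v
  proof (rule LIMSEQ_le[OF _ lim'])
    show "(\<lambda>n. dist ((x \<circ> s) n) v) \<longlonglongrightarrow> dist l v"
      using lim by (intro tendsto_intros)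
    show "\<exists>N. \<forall>n\<ge>N. dist ((x \<circ> s) n) v \<le> \<rho> + 1 / Suc (s n)"
      using x that by (auto simp: subset_iff)
  qed
  then have "K \<subseteq> cball l \<rho>"
    by auto
  then have "P \<rho>"
    by (auto simp: P_def)
  then have "chebyshev_radius K = \<rho>"
    unfolding chebyshev_radius_def using le by (auto simp: P_def intro!: Least_equality)
  then show "\<exists>x. K \<subseteq> cball x (chebyshev_radius K)"
    and "K \<subseteq> cball y r \<Longrightarrow> chebyshev_radius K \<le> r"
    using \<open>P \<rho>\<close> le by (auto simp: P_def)
qed

theorem corollary3:
  fixes K Kc B :: "'a::real_normed_vector set"
  assumes "finite B" and "span B = (UNIV :: 'a set)"
    and "K \<noteq> {}" and "bounded K"
    and "is_completion K Kc"
    and "\<And>C. is_completion K C \<Longrightarrow> C = Kc"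
  shows "chebyshev_radius K = chebyshev_radius Kc \<and> chebyshev_set K = chebyshev_set Kc"
proof -
  note attained = chebyshev_radius_attained[OF \<open>finite B\<close> \<open>span B = UNIV\<close>]
  have Kc: "K \<subseteq> Kc" "Kc \<noteq> {}" "bounded Kc"
    using \<open>is_completion K Kc\<close> \<open>K \<noteq> {}\<close> by (auto simp: is_completion_def diam_complete_def)
  obtain k where "k \<in> K"
    using \<open>K \<noteq> {}\<close> by blast
  then have "K \<subseteq> cball k (diameter K)"
    using diameter_bounded_bound[OF \<open>bounded K\<close>] by auto
  \<comment> \<open>This is the bound on the radius under which a ball containing \<open>K\<close>
    must contain \<open>Kc\<close>.\<close>
  then have le: "chebyshev_radius K \<le> diameter K"
    by (rule attained(2)[OF \<open>K \<noteq> {}\<close> \<open>bounded K\<close>])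
  \<comment> \<open>Both sides use the radius of \<open>K\<close>; this becomes equality of the
    Chebyshev sets once the radii are shown equal.\<close>
  have iff: "K \<subseteq> cball x (chebyshev_radius K) \<longleftrightarrow> Kc \<subseteq> cball x (chebyshev_radius K)" for x
    using unique_completion_subset_cball[OF assms(3-6) _ le, of x] Kc(1) by blast
  obtain x where "Kc \<subseteq> cball x (chebyshev_radius K)"
    using attained(1)[OF \<open>K \<noteq> {}\<close> \<open>bounded K\<close>] iff by blast
  then have "chebyshev_radius Kc \<le> chebyshev_radius K"
    by (rule attained(2)[OF Kc(2,3)])
  moreover obtain y where "Kc \<subseteq> cball y (chebyshev_radius Kc)"
    using attained(1)[OF Kc(2,3)] by blast
  then have "chebyshev_radius K \<le> chebyshev_radius Kc"
    using Kc(1) by (intro attained(2)[OF \<open>K \<noteq> {}\<close> \<open>bounded K\<close>]) blast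
  ultimately have "chebyshev_radius K = chebyshev_radius Kc"
    by linarith
  then show ?thesis
    using iff by (simp add: chebyshev_set_def)
qed

end
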